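(* Let $G$ be a connected interval graph, $K$ a minimal cut set of $G$, and $H$ an arbitrary connected graph vertex disjoint from $G$. If $G'=\mathrm{aug}(G,K,H)$, then $\sigma^{\boxtimes}_V(G')=1$.
   Context: All graphs are finite, simple and non-empty. An interval representation of a graph is a family of (closed) intervals of the real line assigned to the vertices so that two distinct vertices are adjacent if and only if the corresponding intervals intersect; a graph is an interval graph if it has an interval representation. A set $S\subseteq V(G)$ is a cut set of $G$ if $G-S$ has more components than $G$; a cut set $S$ of a connected graph $G$ is a minimal cut set if no proper subset of $S$ is a cut set of $G$. For connected vertex disjoint graphs $G$ and $H$ and $S\subseteq V(G)$, the augmentation of $G$ with respect to $S$ and $H$ is the graph $\mathrm{aug}(G,S,H)$ with vertex set $V(G)\cup V(H)$ and edge set $E(G)\cup E(H)\cup\{sh \mid s\in S,\ h\in V(H)\}$. A function $f: V(P)\to V(H)$ is a weak homomorphism $f:P\to H$ if for every edge $uv\in E(P)$ either $f(u)f(v)\in E(H)$ or $f(u)=f(v)$; it is surjective if $f(V(P))=V(H)$. For weak homomorphisms $f,g:P\to H$ put $m_P(f,g)=\min\{d_H(f(u),g(u)) \mid u\in V(P)\}$, where $d_H$ is the shortest-path distance. For a connected graph $H$, the strong vertex span is $\sigma^{\boxtimes}_V(H)=\max\{m_P(f,g) \mid f,g:P\to H$ are surjective weak homomorphisms and $P$ is a path$\}$. *)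

theory Defs
  imports "Graph_Theory.Graph_Theory"
begin

text \<open>
  A finite simple graph is a \<open>pair_graph\<close>: a finite, loop-free digraph whose arc relation is
  symmetric, an edge \<open>uv\<close> being represented by the two arcs \<open>(u, v)\<close> and \<open>(v, u)\<close>. The library's
  \<open>connected\<close> includes non-emptiness of the vertex set.
\<close>

definition interval_representation :: "'a pair_pre_digraph \<Rightarrow> ('a \<Rightarrow> real set) \<Rightarrow> bool" where
  "interval_representation G I \<longleftrightarrow>
     (\<forall>v \<in> pverts G. \<exists>a b. a \<le> b \<and> I v = {a..b}) \<and>
     (\<forall>u \<in> pverts G. \<forall>v \<in> pverts G. u \<noteq> v \<longrightarrow> ((u, v) \<in> parcs G \<longleftrightarrow> I u \<inter> I v \<noteq> {}))"

definition interval_graph :: "'a pair_pre_digraph \<Rightarrow> bool" where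
  "interval_graph G \<longleftrightarrow> pair_graph G \<and> (\<exists>I. interval_representation G I)"

text \<open>
  The components of a symmetric digraph are its strongly connected components. The null graph,
  which arises for \<open>S = pverts G\<close>, has none.
\<close>

definition num_components :: "('a, 'b) pre_digraph \<Rightarrow> nat" where
  "num_components G = card (pre_digraph.sccs G)"

definition cut_set :: "'a pair_pre_digraph \<Rightarrow> 'a set \<Rightarrow> bool" where
  "cut_set G S \<longleftrightarrow> S \<subseteq> pverts G \<and>
     num_components (with_proj G) < num_components (with_proj G \<restriction> (pverts G - S))"

definition minimal_cut_set :: "'a pair_pre_digraph \<Rightarrow> 'a set \<Rightarrow> bool" where
  "minimal_cut_set G S \<longleftrightarrow> cut_set G S \<and> (\<forall>T. T \<subset> S \<longrightarrow> \<not> cut_set G T)"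

definition aug :: "'a pair_pre_digraph \<Rightarrow> 'a set \<Rightarrow> 'a pair_pre_digraph \<Rightarrow> 'a pair_pre_digraph" where
  "aug G S H =
     \<lparr> pverts = pverts G \<union> pverts H,
       parcs = parcs G \<union> parcs H \<union> S \<times> pverts H \<union> pverts H \<times> S \<rparr>"

definition path_graph :: "'a pair_pre_digraph \<Rightarrow> bool" where
  "path_graph P \<longleftrightarrow> (\<exists>xs. xs \<noteq> [] \<and> distinct xs \<and> pverts P = set xs \<and>
     parcs P = {(xs ! i, xs ! j) | i j.
       i < length xs \<and> j < length xs \<and> (j = Suc i \<or> i = Suc j)})"

definition weak_hom :: "'a pair_pre_digraph \<Rightarrow> 'b pair_pre_digraph \<Rightarrow> ('a \<Rightarrow> 'b) \<Rightarrow> bool" where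
  "weak_hom P H f \<longleftrightarrow> f ` pverts P \<subseteq> pverts H \<and>
     (\<forall>(u, v) \<in> parcs P. (f u, f v) \<in> parcs H \<or> f u = f v)"

definition surj_weak_hom :: "'a pair_pre_digraph \<Rightarrow> 'b pair_pre_digraph \<Rightarrow> ('a \<Rightarrow> 'b) \<Rightarrow> bool" where
  "surj_weak_hom P H f \<longleftrightarrow> weak_hom P H f \<and> f ` pverts P = pverts H"

text \<open>
  The library's shortest-path distance \<open>\<mu>\<close> for unit weights. It is extended-real valued, with
  value \<open>\<infinity>\<close> exactly between vertices in different components.
\<close>

definition gdist :: "'a pair_pre_digraph \<Rightarrow> 'a \<Rightarrow> 'a \<Rightarrow> ereal" where
  "gdist H u v = wf_digraph.\<mu> (with_proj H) (\<lambda>_. 1) u v"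

definition min_dist ::
  "'a pair_pre_digraph \<Rightarrow> 'b pair_pre_digraph \<Rightarrow> ('a \<Rightarrow> 'b) \<Rightarrow> ('a \<Rightarrow> 'b) \<Rightarrow> ereal" where
  "min_dist P H f g = Min {gdist H (f u) (g u) | u. u \<in> pverts P}"

text \<open>
  Every finite path is isomorphic to one whose vertices are natural numbers, so \<open>P\<close> may be taken to
  range over paths of this type. For a finite connected graph \<open>H\<close> the set below consists of natural
  numbers smaller than \<open>card (pverts H)\<close> and is non-empty, so its maximum exists.
\<close>

definition strong_vertex_span :: "'a pair_pre_digraph \<Rightarrow> ereal" where
  "strong_vertex_span H = Max {min_dist P H f g | (P :: nat pair_pre_digraph) f g.
     path_graph P \<and> surj_weak_hom P H f \<and> surj_weak_hom P H g}"

end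

theory Submission
  imports Defs
begin

text \<open>
  Fix an interval representation of \<open>G\<close>. Since \<open>G - K\<close> is disconnected, the line contains a point
  \<open>p\<close> that lies in no interval of \<open>G - K\<close> and has such intervals on both sides. The vertices whose
  intervals contain \<open>p\<close> form a cut set inside \<open>K\<close>, hence equal \<open>K\<close> by minimality.

  Assign the interval \<open>[p, p]\<close> to every vertex of \<open>H\<close>. This represents the augmented graph, except
  that nonadjacent vertices of \<open>H\<close> also have intersecting intervals. Suppose two players, moving along
  surjective weak homomorphisms, never meet and are never adjacent. They are never both in \<open>H\<close>: the
  first step after which they are not both there would take one of them to \<open>K\<close>, a clique completely
  joined to \<open>H\<close>, and the other to \<open>K\<close> or \<open>H\<close>. So their intervals are always disjoint, and one step
  cannot change which one is on the left. But the left player eventually visits a vertex with the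
  largest left endpoint, a contradiction. Conversely, a closed walk run with a delay of one step keeps
  the players apart.
\<close>

section \<open>Distances and spans\<close>

context pair_wf_digraph
begin

lemma gdist_self: "u \<in> pverts G \<Longrightarrow> gdist G u u \<le> 0"
  unfolding gdist_def
  using min_cost_le_walk_cost[of u "[]" u "\<lambda>_. 1"] by (simp add: awalk_Nil_iff zero_ereal_def)

lemma gdist_arc: "(u, v) \<in> parcs G \<Longrightarrow> gdist G u v \<le> 1"
  unfolding gdist_def
  using min_cost_le_walk_cost[of u "[(u, v)]" v "\<lambda>_. 1"]
  by (auto simp: awalk_simps one_ereal_def dest: wellformed')

lemma gdist_nonneg: "0 \<le> gdist G u v"
  unfolding gdist_def \<mu>_def
  by (auto intro!: INF_greatest pos_cost_pos_awalk_cost)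

lemma gdist_ge_1:
  assumes "u \<noteq> v"
  shows "1 \<le> gdist G u v"
  unfolding gdist_def \<mu>_def
proof (rule INF_greatest)
  fix p assume "p \<in> {p. awalk u p v}"
  then have w: "awalk u p v" by simp
  then obtain e es where p: "p = e # es"
    using assms by (cases p) (auto simp: awalk_Nil_iff)
  then have "awalk (snd e) es v"
    using w by (simp add: awalk_Cons_iff)
  then have "0 \<le> awalk_cost (\<lambda>_. 1) es"
    by (rule pos_cost_pos_awalk_cost) simp
  then show "1 \<le> ereal (awalk_cost (\<lambda>_. 1) p)"
    by (simp add: p)
qed

text \<open>Distances are extended reals here; this gap between 0 and 1 does the work of
  integrality.\<close>

lemma gdist_eq_0_or_ge_1: "u \<in> pverts G \<Longrightarrow> gdist G u v = 0 \<or> 1 \<le> gdist G u v"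
  using gdist_self gdist_nonneg gdist_ge_1 by (metis antisym)

end

section \<open>Paths and surjective weak homomorphisms\<close>

lemma path_graph_finite: "path_graph P \<Longrightarrow> finite (pverts P) \<and> pverts P \<noteq> {}"
  by (auto simp: path_graph_def)

text \<open>Every edge of a path is present in both orientations, so a property preserved along arcs
  spreads from any vertex to the whole path. It carries the invariants on the joint position of the
  two players.\<close>

lemma path_graph_induct:
  assumes P: "path_graph P" and u: "u \<in> pverts P" "Q u" and v: "v \<in> pverts P"
    and step: "\<And>x y. (x, y) \<in> parcs P \<Longrightarrow> Q x \<Longrightarrow> Q y"
  shows "Q v"
proof -
  obtain xs where xs: "xs \<noteq> []" "pverts P = set xs"
    "parcs P = {(xs ! i, xs ! j) | i j.
       i < length xs \<and> j < length xs \<and> (j = Suc i \<or> i = Suc j)}"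
    using P unfolding path_graph_def by blast
  \<comment> \<open>The equivalence allows going from \<open>u\<close> back to index 0 and then
    forward to \<open>v\<close>.\<close>
  have *: "Q (xs ! i) \<longleftrightarrow> Q (xs ! 0)" if "i < length xs" for i
    using that
  proof (induction i)
    case (Suc i)
    then have "(xs ! i, xs ! Suc i) \<in> parcs P" "(xs ! Suc i, xs ! i) \<in> parcs P"
      unfolding xs(3) by force+
    then show ?case using Suc step by (meson Suc_lessD)
  qed simp
  obtain i j where "i < length xs" "u = xs ! i" "j < length xs" "v = xs ! j"
    using u v unfolding xs(2) by (metis in_set_conv_nth)
  then show ?thesis using * u by blast
qed

lemma surj_weak_homD:
  assumes "surj_weak_hom P H f"
  shows "u \<in> pverts P \<Longrightarrow> f u \<in> pverts H"
    and "(u, v) \<in> parcs P \<Longrightarrow> f u = f v \<or> (f u, f v) \<in> parcs H"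
    and "w \<in> pverts H \<Longrightarrow> \<exists>u \<in> pverts P. f u = w"
proof -
  show "\<exists>u \<in> pverts P. f u = w" if "w \<in> pverts H"
    using assms that unfolding surj_weak_hom_def by (metis imageE)
qed (use assms in \<open>auto simp: surj_weak_hom_def weak_hom_def\<close>)

text \<open>A meeting bounds the minimum by 1. The minimum is attained, so it is itself a distance,
  and the gap below 1 leaves only two values.\<close>

lemma (in pair_wf_digraph) min_dist_0_1:
  assumes P: "path_graph P" and f: "f ` pverts P \<subseteq> pverts G"
    and meet: "\<exists>u \<in> pverts P. f u = g u \<or> (f u, g u) \<in> parcs G"
  shows "min_dist P G f g = 0 \<or> min_dist P G f g = 1"
proof -
  let ?A = "{gdist G (f u) (g u) | u. u \<in> pverts P}"
  have A: "finite ?A" "?A \<noteq> {}"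
    using path_graph_finite[OF P] by auto
  then have in_A: "Min ?A \<in> ?A" by (rule Min_in)
  obtain u where u: "u \<in> pverts P" "f u = g u \<or> (f u, g u) \<in> parcs G"
    using meet by blast
  have "Min ?A \<le> gdist G (f u) (g u)"
    using A u(1) by (intro Min_le) auto
  also have "gdist G (f u) (g u) \<le> 1"
    using u(2)
  proof
    assume "f u = g u"
    then have "gdist G (f u) (g u) \<le> 0" using f u(1) gdist_self by auto
    then show ?thesis by (rule order_trans) simp
  qed (rule gdist_arc)
  finally have "Min ?A \<le> 1" .
  moreover obtain v where v: "v \<in> pverts P" "Min ?A = gdist G (f v) (g v)"
    using in_A by blast
  moreover have "gdist G (f v) (g v) = 0 \<or> 1 \<le> gdist G (f v) (g v)"
    using f v(1) by (intro gdist_eq_0_or_ge_1) auto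
  ultimately show ?thesis
    unfolding min_dist_def by (metis antisym)
qed

lemma (in pair_wf_digraph) min_dist_ge_1:
  assumes P: "path_graph P" and ne: "\<And>u. u \<in> pverts P \<Longrightarrow> f u \<noteq> g u"
  shows "1 \<le> min_dist P G f g"
  unfolding min_dist_def
  using path_graph_finite[OF P] ne gdist_ge_1 by (subst Min_ge_iff) auto

section \<open>Closed walks and the value of the span\<close>

text \<open>Every inner vertex of a walk is the head of one arc and the tail of the next, so tails
  and heads can differ only in the two ends.\<close>

lemma pcas_fst_snd: "pcas u p v \<Longrightarrow> insert v (fst ` set p) = insert u (snd ` set p)"
proof (induction p arbitrary: u)
  case (Cons e p)
  then have "insert v (fst ` set p) = insert (snd e) (snd ` set p)" by simp
  then show ?case using Cons.prems by (simp add: insert_commute[of v])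
qed simp

lemma pcas_snd_last: "pcas u p v \<Longrightarrow> p \<noteq> [] \<Longrightarrow> snd (last p) = v"
  by (induction p arbitrary: u) auto

lemma pcas_nth: "pcas u p v \<Longrightarrow> Suc i < length p \<Longrightarrow> snd (p ! i) = fst (p ! Suc i)"
proof (induction p arbitrary: u i)
  case (Cons e p)
  then show ?case by (cases i; cases p) auto
qed simp

text \<open>Excursions from \<open>r\<close> to each vertex and back are concatenated.\<close>

lemma (in pair_fin_digraph) closed_covering_walk:
  assumes conn: "strongly_connected (with_proj G)" and "r \<in> pverts G"
  shows "\<exists>p. awalk r p r \<and> pverts G \<subseteq> insert r (fst ` set p)"
proof -
  have "\<exists>p. awalk r p r \<and> A \<subseteq> insert r (fst ` set p)" if "finite A" "A \<subseteq> pverts G" for A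
    using that
  proof (induction A)
    case empty
    show ?case using assms by (intro exI[of _ "[]"]) (simp add: awalk_Nil_iff)
  next
    case (insert x A)
    then obtain p where p: "awalk r p r" "A \<subseteq> insert r (fst ` set p)" by auto
    have "r \<rightarrow>\<^sup>*\<^bsub>G\<^esub> x" "x \<rightarrow>\<^sup>*\<^bsub>G\<^esub> r"
      using conn assms(2) insert.prems by (auto simp: strongly_connected_def)
    then obtain q q' where q: "awalk r q x" "awalk x q' r"
      unfolding reachable_awalk by blast
    \<comment> \<open>The return walk \<open>q'\<close> has \<open>x\<close> as its first tail,
      unless it is empty and \<open>x = r\<close>.\<close>
    have "x \<in> insert r (fst ` set q')"
      using q(2) by (cases q') (auto simp: awalk_simps)
    moreover have "awalk r (p @ q @ q') r"
      using p q by auto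
    ultimately show ?case
      using p(2) by (intro exI[of _ "p @ q @ q'"]) auto
  qed
  then show ?thesis using pair_finite_verts by blast
qed

text \<open>The path has one vertex for each arc of a closed covering walk; the players stand at the
  tail and at the head of that arc. Absence of loops keeps them apart, and closedness lets both see
  every vertex.\<close>

lemma (in pair_graph) distinct_surj_weak_homs:
  assumes conn: "strongly_connected (with_proj G)" and "r \<in> pverts G" "s \<in> pverts G" "r \<noteq> s"
  shows "\<exists>(P :: nat pair_pre_digraph) f g. path_graph P \<and> surj_weak_hom P G f \<and>
    surj_weak_hom P G g \<and> (\<forall>u \<in> pverts P. f u \<noteq> g u)"
proof -
  obtain p where p: "awalk r p r" "pverts G \<subseteq> insert r (fst ` set p)"
    using closed_covering_walk assms by blast
  then have arcs: "set p \<subseteq> parcs G" and cas: "pcas r p r"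
    unfolding awalk_def by auto
  \<comment> \<open>An empty walk would cover only \<open>r\<close> and miss
    \<open>s\<close>.\<close>
  have "p \<noteq> []" using p(2) assms by auto
  then have "fst (hd p) = r" "snd (last p) = r"
    using cas pcas_snd_last[OF cas] by (cases p; simp)+
  \<comment> \<open>As \<open>r\<close> is both a tail and a head, the extra \<open>insert r\<close>
    in the covering property and in \<open>pcas_fst_snd\<close> disappears.\<close>
  then have "r \<in> fst ` set p" "r \<in> snd ` set p"
    using \<open>p \<noteq> []\<close> by (metis imageI hd_in_set last_in_set)+
  then have "fst ` set p = snd ` set p" "pverts G \<subseteq> fst ` set p"
    using pcas_fst_snd[OF cas] p(2) by (simp_all add: insert_absorb)
  moreover have "fst ` set p \<subseteq> pverts G"
    using arcs arc_fst_in_verts by blast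
  ultimately have im: "fst ` set p = pverts G" "snd ` set p = pverts G"
    by simp_all
  have nth: "p ! i \<in> parcs G" if "i < length p" for i
    using that arcs by auto
  \<comment> \<open>The second player is always one arc of the closed walk ahead of the first.\<close>
  define P :: "nat pair_pre_digraph" where
    "P = \<lparr> pverts = {..<length p},
           parcs = {(i, j). i < length p \<and> j < length p \<and> (j = Suc i \<or> i = Suc j)} \<rparr>"
  have "path_graph P"
    unfolding path_graph_def
  proof (intro exI[of _ "[0..<length p]"] conjI)
    have arcs_P: "parcs P = {(i, j) | i j. i < length p \<and> j < length p \<and> (j = Suc i \<or> i = Suc j)}"
      by (simp add: P_def)
    show "parcs P = {([0..<length p] ! i, [0..<length p] ! j) | i j.
        i < length [0..<length p] \<and> j < length [0..<length p] \<and> (j = Suc i \<or> i = Suc j)}"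
      unfolding arcs_P by (intro Collect_cong ex_cong1) auto
  qed (use \<open>p \<noteq> []\<close> in \<open>auto simp: P_def\<close>)
  moreover have set_p: "(\<lambda>i. p ! i) ` {..<length p} = set p"
    by (auto simp: set_conv_nth)
  have sur: "(\<lambda>i. h (p ! i)) ` {..<length p} = h ` set p" for h :: "'a \<times> 'a \<Rightarrow> 'a"
    using set_p by (metis image_image)
  \<comment> \<open>Consecutive tails are joined by the arc \<open>p ! i\<close>, consecutive heads
    by \<open>p ! Suc i\<close>; symmetry gives the reversed steps.\<close>
  have "(fst (p ! i), fst (p ! Suc i)) \<in> parcs G \<and> (fst (p ! Suc i), fst (p ! i)) \<in> parcs G
      \<and> (snd (p ! i), snd (p ! Suc i)) \<in> parcs G \<and> (snd (p ! Suc i), snd (p ! i)) \<in> parcs G"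
    if "Suc i < length p" for i
    using that nth[of i] nth[of "Suc i"] pcas_nth[OF cas that] arcs_symmetric
    by (metis Suc_lessD prod.collapse)
  then have "surj_weak_hom P G (\<lambda>i. fst (p ! i))" "surj_weak_hom P G (\<lambda>i. snd (p ! i))"
    using im sur unfolding surj_weak_hom_def weak_hom_def P_def by auto
  moreover have "\<forall>i \<in> pverts P. fst (p ! i) \<noteq> snd (p ! i)"
    using nth pair_no_loops unfolding P_def by auto
  ultimately show ?thesis by blast
qed

text \<open>By \<open>meet\<close> all values of \<open>min_dist\<close> lie in {0, 1}, so the set
  under \<open>Max\<close> is finite. The delayed closed walk attains 1.\<close>

lemma (in pair_graph) strong_vertex_span_eq_1:
  assumes conn: "strongly_connected (with_proj G)" and "r \<in> pverts G" "s \<in> pverts G" "r \<noteq> s"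
    and meet: "\<And>(P :: nat pair_pre_digraph) f g.
      \<lbrakk>path_graph P; surj_weak_hom P G f; surj_weak_hom P G g\<rbrakk> \<Longrightarrow>
      \<exists>u \<in> pverts P. f u = g u \<or> (f u, g u) \<in> parcs G"
  shows "strong_vertex_span G = 1"
proof -
  let ?A = "{min_dist P G f g | (P :: nat pair_pre_digraph) f g.
     path_graph P \<and> surj_weak_hom P G f \<and> surj_weak_hom P G g}"
  have sub: "?A \<subseteq> {0, 1}"
  proof
    fix x assume "x \<in> ?A"
    then obtain P :: "nat pair_pre_digraph" and f g where x: "x = min_dist P G f g"
      and Pfg: "path_graph P" "surj_weak_hom P G f" "surj_weak_hom P G g"
      by blast
    have "f ` pverts P \<subseteq> pverts G"
      using Pfg(2) unfolding surj_weak_hom_def by simp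
    then show "x \<in> {0, 1}"
      using min_dist_0_1[OF Pfg(1) _ meet[OF Pfg]] x by simp
  qed
  obtain P :: "nat pair_pre_digraph" and f g where Pfg: "path_graph P" "surj_weak_hom P G f"
    "surj_weak_hom P G g" "\<forall>u \<in> pverts P. f u \<noteq> g u"
    using distinct_surj_weak_homs assms by blast
  then have in_A: "min_dist P G f g \<in> ?A" by blast
  have "1 \<le> min_dist P G f g" using Pfg by (intro min_dist_ge_1) auto
  then have "min_dist P G f g \<noteq> 0" by auto
  then have "min_dist P G f g = 1" using subsetD[OF sub in_A] by simp
  then have "1 \<in> ?A" using in_A by simp
  have "Max ?A = 1"
  proof (rule Max_eqI)
    show "finite ?A" using sub by (rule finite_subset) simp
    show "x \<le> 1" if "x \<in> ?A" for x using subsetD[OF sub that] by auto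
  qed fact
  then show ?thesis unfolding strong_vertex_span_def .
qed

section \<open>Cut sets of interval graphs\<close>

text \<open>A connected graph has exactly one component, so having more means having two. By
  symmetry, two vertices share a strong component as soon as one reaches the other.\<close>

lemma (in pair_graph) cut_set_iff:
  assumes conn: "connected (with_proj G)"
  shows "cut_set G S \<longleftrightarrow> S \<subseteq> pverts G \<and>
    (\<exists>u \<in> pverts G - S. \<exists>v \<in> pverts G - S. \<not> u \<rightarrow>\<^sup>*\<^bsub>with_proj G \<restriction> (pverts G - S)\<^esub> v)"
proof -
  let ?D = "with_proj G \<restriction> (pverts G - S)"
  have "strongly_connected (with_proj G)"
    using symmetric_connected_imp_strongly_connected conn sym_arcs by blast
  then have one: "num_components (with_proj G) = 1"
    unfolding num_components_def using strongly_connected_eq_iff by simp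
  interpret D: wf_digraph ?D by auto
  interpret D: fin_digraph ?D
    using pair_finite_verts pair_finite_arcs by unfold_locales auto
  have sym: "symmetric ?D"
    using induced_graph_imp_symmetric[OF sym_arcs induced_induce] by blast
  have "num_components ?D = card (D.scc_of ` (pverts G - S))"
    unfolding num_components_def using D.card_sccs_verts D.sccs_verts_conv_scc_of by simp
  moreover have "D.scc_of u = D.scc_of v \<longleftrightarrow> u \<rightarrow>\<^sup>*\<^bsub>?D\<^esub> v" if "u \<in> pverts G - S" "v \<in> pverts G - S" for u v
  proof
    assume "D.scc_of u = D.scc_of v"
    moreover have "v \<in> D.scc_of v" using that by (simp add: D.in_scc_of_self)
    ultimately show "u \<rightarrow>\<^sup>*\<^bsub>?D\<^esub> v" by (auto simp: D.scc_of_def)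
  next
    assume "u \<rightarrow>\<^sup>*\<^bsub>?D\<^esub> v"
    then have "u \<in> D.scc_of v" using symmetric_reachable[OF sym] by (auto simp: D.scc_of_def)
    then show "D.scc_of u = D.scc_of v" by (rule D.scc_of_eq)
  qed
  moreover have "1 < card (f ` A) \<longleftrightarrow> (\<exists>u \<in> A. \<exists>v \<in> A. f u \<noteq> f v)" if "finite A"
    for f :: "'a \<Rightarrow> 'a set" and A
    using that card_le_Suc0_iff_eq[of "f ` A"] by (auto simp: not_le[symmetric])
  ultimately show ?thesis
    unfolding cut_set_def one using pair_finite_verts by force
qed

section \<open>Gaps between separated families of intervals\<close>

text \<open>
  With \<open>b\<close> the leftmost interval of \<open>B\<close>, the gap lies between \<open>b\<close> and the intervals of \<open>A\<close>
  that start before it, all of which also end before it.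
\<close>

lemma interval_gap_aux:
  fixes l r :: "'a \<Rightarrow> real"
  assumes fin: "finite A" "finite B" and a: "a \<in> A" and B: "B \<noteq> {}"
    and min: "\<And>v. v \<in> B \<Longrightarrow> l a \<le> l v"
    and lr: "\<And>v. v \<in> A \<union> B \<Longrightarrow> l v \<le> r v"
    and sep: "\<And>u v. u \<in> A \<Longrightarrow> v \<in> B \<Longrightarrow> r u < l v \<or> r v < l u"
  shows "\<exists>p. (\<forall>v \<in> A \<union> B. r v < p \<or> p < l v) \<and> (\<exists>v \<in> A \<union> B. r v < p) \<and> (\<exists>v \<in> A \<union> B. p < l v)"
proof -
  obtain b where b: "b \<in> B" "\<And>v. v \<in> B \<Longrightarrow> l b \<le> l v"
    using arg_min_least[of B _ l] arg_min_if_finite(1)[of B l] fin B by blast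
  let ?C = "{v \<in> A. l v \<le> l b}"
  have ab: "r a < l b"
    using sep[OF a b(1)] min[OF b(1)] lr b(1) by force
  have C: "finite ?C" "a \<in> ?C" using fin a min b by auto
  \<comment> \<open>The rightmost end among the intervals of \<open>A\<close> starting no later than
    \<open>b\<close>. The family \<open>?C\<close> contains \<open>a\<close>, so the maximum
    exists.\<close>
  define m where "m = Max (r ` ?C)"
  have m: "r v \<le> m" if "v \<in> ?C" for v
    unfolding m_def using C that by auto
  have "m \<in> r ` ?C" unfolding m_def using C by (intro Max_in) auto
  then obtain c where c: "c \<in> ?C" "m = r c" by blast
  then have "m < l b" using sep[of c b] b(1) lr by force
  define p where "p = (m + l b) / 2"
  have p: "m < p" "p < l b" using \<open>m < l b\<close> by (auto simp: p_def)
  \<comment> \<open>An interval starting after \<open>l b\<close> lies right of \<open>p\<close>.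
    Otherwise it is in \<open>?C\<close> and ends by \<open>m\<close>, or it is in \<open>B\<close>
    and starts exactly at \<open>l b\<close>.\<close>
  have "r v < p \<or> p < l v" if "v \<in> A \<union> B" for v
    using that p m b(2) by (cases "l v \<le> l b") force+
  moreover have "r a < p" using m C(2) p by force
  ultimately show ?thesis using a b(1) p(2) by blast
qed

text \<open>The situation is symmetric, so the family holding the overall smallest left endpoint
  plays the role of \<open>A\<close> in \<open>interval_gap_aux\<close>.\<close>

lemma interval_gap:
  fixes l r :: "'a \<Rightarrow> real"
  assumes fin: "finite A" "finite B" and A: "A \<noteq> {}" and B: "B \<noteq> {}"
    and lr: "\<And>v. v \<in> A \<union> B \<Longrightarrow> l v \<le> r v"
    and sep: "\<And>u v. u \<in> A \<Longrightarrow> v \<in> B \<Longrightarrow> r u < l v \<or> r v < l u"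
  shows "\<exists>p. (\<forall>v \<in> A \<union> B. r v < p \<or> p < l v) \<and> (\<exists>v \<in> A \<union> B. r v < p) \<and> (\<exists>v \<in> A \<union> B. p < l v)"
proof -
  obtain a where a: "a \<in> A \<union> B" "\<And>v. v \<in> A \<union> B \<Longrightarrow> l a \<le> l v"
    using arg_min_least[of "A \<union> B" _ l] arg_min_if_finite(1)[of "A \<union> B" l] fin A by blast
  show ?thesis
  proof (cases "a \<in> A")
    case True
    then show ?thesis using interval_gap_aux[of A B a l r] assms a by blast
  next
    case False
    then have "a \<in> B" using a by blast
    moreover have "\<And>u v. u \<in> B \<Longrightarrow> v \<in> A \<Longrightarrow> r u < l v \<or> r v < l u"
      using sep by blast
    ultimately show ?thesis using interval_gap_aux[of B A a l r] fin A a lr by (simp add: Un_commute)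
  qed
qed

section \<open>Minimal cut sets as the intervals through a point\<close>

lemma interval_graph_endpoints:
  assumes "interval_graph G"
  obtains l r :: "'a \<Rightarrow> real" where "\<And>v. v \<in> pverts G \<Longrightarrow> l v \<le> r v"
    "\<And>u v. \<lbrakk>u \<in> pverts G; v \<in> pverts G; u \<noteq> v\<rbrakk> \<Longrightarrow> (u, v) \<in> parcs G \<longleftrightarrow> l u \<le> r v \<and> l v \<le> r u"
proof -
  obtain I where I: "interval_representation G I"
    using assms unfolding interval_graph_def by blast
  then have "\<forall>v. \<exists>a b :: real. v \<in> pverts G \<longrightarrow> a \<le> b \<and> I v = {a..b}"
    unfolding interval_representation_def by blast
  then obtain l r where lr: "\<And>v. v \<in> pverts G \<Longrightarrow> l v \<le> r v" "\<And>v. v \<in> pverts G \<Longrightarrow> I v = {l v..r v}"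
    by metis
  have "(u, v) \<in> parcs G \<longleftrightarrow> l u \<le> r v \<and> l v \<le> r u"
    if "u \<in> pverts G" "v \<in> pverts G" "u \<noteq> v" for u v
  proof -
    have "(u, v) \<in> parcs G \<longleftrightarrow> {l u..r u} \<inter> {l v..r v} \<noteq> {}"
      using I that lr unfolding interval_representation_def by metis
    also have "\<dots> \<longleftrightarrow> l u \<le> r v \<and> l v \<le> r u"
      using lr(1)[OF that(1)] lr(1)[OF that(2)] by (auto simp: Int_atLeastAtMost)
    finally show ?thesis .
  qed
  then show ?thesis using that lr by blast
qed

lemma (in pair_graph) minimal_cut_set_interval:
  fixes l r :: "'a \<Rightarrow> real"
  assumes conn: "connected (with_proj G)" and K: "minimal_cut_set G K"
    and lr: "\<And>v. v \<in> pverts G \<Longrightarrow> l v \<le> r v"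
    and adj: "\<And>u v. \<lbrakk>u \<in> pverts G; v \<in> pverts G; u \<noteq> v\<rbrakk> \<Longrightarrow>
      (u, v) \<in> parcs G \<longleftrightarrow> l u \<le> r v \<and> l v \<le> r u"
  obtains p where "K = {v \<in> pverts G. l v \<le> p \<and> p \<le> r v}"
proof -
  let ?W = "pverts G - K" and ?D = "with_proj G \<restriction> (pverts G - K)"
  interpret D: wf_digraph ?D by auto
  have "cut_set G K" using K unfolding minimal_cut_set_def by (rule conjunct1)
  then obtain a b where ab: "a \<in> ?W" "b \<in> ?W" "\<not> a \<rightarrow>\<^sup>*\<^bsub>?D\<^esub> b"
    unfolding cut_set_iff[OF conn] by blast
  define A where "A = {v \<in> ?W. a \<rightarrow>\<^sup>*\<^bsub>?D\<^esub> v}"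
  \<comment> \<open>\<open>A\<close> is the component of \<open>a\<close> in \<open>G - K\<close>;
    an overlap with an interval outside \<open>A\<close> would be an edge leaving the
    component.\<close>
  have sep: "r u < l v \<or> r v < l u" if "u \<in> A" "v \<in> ?W - A" for u v
  proof (rule ccontr)
    assume "\<not> ?thesis"
    then have "(u, v) \<in> parcs G" using adj[of u v] that unfolding A_def by force
    then have "u \<rightarrow>\<^bsub>?D\<^esub> v"
      using that unfolding A_def arcs_ends_def arc_to_ends_def by force
    then have "a \<rightarrow>\<^sup>*\<^bsub>?D\<^esub> v" using that D.reachable_adj_trans unfolding A_def by blast
    then show False using that unfolding A_def by blast
  qed
  have A: "A \<subseteq> ?W" "a \<in> A" "b \<in> ?W - A" using ab unfolding A_def by auto
  then have "finite A" "finite (?W - A)" "A \<noteq> {}" "?W - A \<noteq> {}" and un: "A \<union> (?W - A) = ?W"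
    using pair_finite_verts by (auto intro: finite_subset)
  then have "\<exists>p. (\<forall>v \<in> ?W. r v < p \<or> p < l v) \<and> (\<exists>v \<in> ?W. r v < p) \<and> (\<exists>v \<in> ?W. p < l v)"
    using interval_gap[of A "?W - A" l r] sep lr unfolding un by blast
  then obtain p where p: "\<And>v. v \<in> ?W \<Longrightarrow> r v < p \<or> p < l v"
    and ex: "\<exists>v \<in> ?W. r v < p" "\<exists>v \<in> ?W. p < l v"
    by blast
  define T where "T = {v \<in> pverts G. l v \<le> p \<and> p \<le> r v}"
  have "T \<subseteq> K" using p unfolding T_def by force
  obtain x y where xy: "x \<in> ?W" "r x < p" "y \<in> ?W" "p < l y" using ex by blast
  let ?E = "with_proj G \<restriction> (pverts G - T)"
  interpret E: wf_digraph ?E by auto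
  \<comment> \<open>Lying left of \<open>p\<close> is invariant off \<open>T\<close>: a neighbour's
    interval meets one that ends before \<open>p\<close>, so it starts before \<open>p\<close>, and
    as it avoids \<open>p\<close> it also ends before \<open>p\<close>.\<close>
  have "r v < p" if "x \<rightarrow>\<^sup>*\<^bsub>?E\<^esub> v" for v
    using that
  proof (induction rule: E.reachable_induct)
    case base
    show ?case using xy by simp
  next
    case (step u v)
    then have "(u, v) \<in> parcs G" "u \<in> pverts G - T" "v \<in> pverts G - T"
      unfolding arcs_ends_def arc_to_ends_def by auto
    then show ?case using adj[of u v] no_loops' step.IH unfolding T_def by force
  qed
  then have "\<not> x \<rightarrow>\<^sup>*\<^bsub>?E\<^esub> y" using xy lr by force
  moreover have "x \<in> pverts G - T" "y \<in> pverts G - T" using xy \<open>T \<subseteq> K\<close> by auto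
  moreover have "T \<subseteq> pverts G" unfolding T_def by blast
  ultimately have "cut_set G T" using cut_set_iff[OF conn] by blast
  then have "T = K" using K \<open>T \<subseteq> K\<close> unfolding minimal_cut_set_def by blast
  then show ?thesis using that unfolding T_def by blast
qed

lemma (in pair_graph) cut_set_nonempty:
  assumes "cut_set G S"
  shows "S \<noteq> {}"
proof
  assume "S = {}"
  moreover have "with_proj G \<restriction> pverts G = with_proj G"
    unfolding induce_subgraph_def with_proj_def by (auto dest: wellformed')
  ultimately show False using assms unfolding cut_set_def by simp
qed

section \<open>Augmented interval graphs\<close>

lemma aug_simps [simp]:
  "pverts (aug G S H) = pverts G \<union> pverts H"
  "parcs (aug G S H) = parcs G \<union> parcs H \<union> S \<times> pverts H \<union> pverts H \<times> S"
  by (simp_all add: aug_def)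

lemma pair_graph_aug:
  assumes "pair_graph G" "pair_graph H" "S \<subseteq> pverts G" "pverts G \<inter> pverts H = {}"
  shows "pair_graph (aug G S H)"
proof -
  interpret G: pair_graph G by fact
  interpret H: pair_graph H by fact
  show ?thesis
  proof
    show "symmetric (with_proj (aug G S H))"
      using G.arcs_symmetric H.arcs_symmetric unfolding symmetric_def by (auto intro!: symI)
    show "finite (pverts (aug G S H))" "finite (parcs (aug G S H))"
      using assms(3) finite_subset[OF assms(3)] by simp_all
    show "fst e \<in> pverts (aug G S H)" "snd e \<in> pverts (aug G S H)"
      if "e \<in> parcs (aug G S H)" for e
      using that assms(3) G.arc_fst_in_verts G.arc_snd_in_verts H.arc_fst_in_verts H.arc_snd_in_verts
      by auto
    show "fst e \<noteq> snd e" if "e \<in> parcs (aug G S H)" for e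
      using that assms(3,4) G.pair_no_loops H.pair_no_loops by auto
  qed
qed

text \<open>Every vertex reaches a fixed \<open>s\<close> in \<open>S\<close>: inside
  \<open>G\<close> by connectedness, from \<open>H\<close> by a single new edge. Symmetry gives the
  way back.\<close>

lemma strongly_connected_aug:
  assumes "pair_graph G" "pair_graph H" "S \<subseteq> pverts G" "S \<noteq> {}"
    and "connected (with_proj G)" "connected (with_proj H)" "pverts G \<inter> pverts H = {}"
  shows "strongly_connected (with_proj (aug G S H))"
proof -
  interpret G: pair_graph G by fact
  interpret H: pair_graph H by fact
  interpret A: pair_graph "aug G S H" using pair_graph_aug assms by blast
  have GH: "strongly_connected (with_proj G)" "strongly_connected (with_proj H)"
    using assms G.symmetric_connected_imp_strongly_connected G.sym_arcs
      H.symmetric_connected_imp_strongly_connected H.sym_arcs by blast+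
  obtain s where s: "s \<in> S" "s \<in> pverts G" using assms by blast
  have G: "u \<rightarrow>\<^sup>*\<^bsub>aug G S H\<^esub> s" if "u \<in> pverts G" for u
  proof -
    have "u \<rightarrow>\<^sup>*\<^bsub>G\<^esub> s" using GH that s by (auto simp: strongly_connected_def)
    then show ?thesis
      unfolding reachable_def by (rule rtrancl_on_mono[rotated 2]) auto
  qed
  have to_s: "u \<rightarrow>\<^sup>*\<^bsub>aug G S H\<^esub> s" if "u \<in> pverts (aug G S H)" for u
  proof (cases "u \<in> pverts G")
    case False
    then have "(u, s) \<in> parcs (aug G S H)" using that s by auto
    then show ?thesis by auto
  qed (rule G)
  show ?thesis
  proof
    fix u v assume "u \<in> verts (aug G S H)" "v \<in> verts (aug G S H)"
    then have "u \<rightarrow>\<^sup>*\<^bsub>aug G S H\<^esub> s" "v \<rightarrow>\<^sup>*\<^bsub>aug G S H\<^esub> s"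
      using to_s by auto
    then show "u \<rightarrow>\<^sup>*\<^bsub>aug G S H\<^esub> v"
      using A.symmetric_reachable' A.reachable_trans by blast
  qed (use s in auto)
qed

section \<open>Two players on an augmented interval graph\<close>

text \<open>Only one direction of a representation is assumed: adjacent vertices have meeting
  intervals. This admits collapsing \<open>H\<close> to a point, where nonadjacent vertices meet as
  well.\<close>

lemma no_order_preserving_pair:
  fixes L R :: "'a \<Rightarrow> real"
  assumes P: "path_graph P" and f: "surj_weak_hom P G f" and g: "surj_weak_hom P G g"
    and fin: "finite (pverts G)"
    and LR: "\<And>v. v \<in> pverts G \<Longrightarrow> L v \<le> R v"
    and adj: "\<And>u v. (u, v) \<in> parcs G \<Longrightarrow> L u \<le> R v \<and> L v \<le> R u"
    and disj: "\<And>u. u \<in> pverts P \<Longrightarrow> R (f u) < L (g u) \<or> R (g u) < L (f u)"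
    and u: "u \<in> pverts P" "R (f u) < L (g u)"
  shows False
proof -
  have ord: "R (f v) < L (g v)" if "v \<in> pverts P" for v
  proof (rule path_graph_induct[where Q = "\<lambda>v. R (f v) < L (g v)", OF P u that])
    fix x y assume xy: "(x, y) \<in> parcs P" "R (f x) < L (g x)"
    then have mem: "x \<in> pverts P" "y \<in> pverts P"
      using P unfolding path_graph_def by auto
    \<comment> \<open>Each player's old and new intervals meet. A swap
      \<open>R (g y) < L (f y)\<close> would give
      \<open>R (g y) < L (f y) \<le> R (f x) < L (g x) \<le> R (g y)\<close>.\<close>
    have "L (f y) \<le> R (f x)" "L (g x) \<le> R (g y)"
      using surj_weak_homD(2)[OF f xy(1)] surj_weak_homD(2)[OF g xy(1)] adj LR
        surj_weak_homD(1)[OF f] surj_weak_homD(1)[OF g] mem by metis+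
    then show "R (f y) < L (g y)" using disj[OF mem(2)] xy(2) by linarith
  qed
  have "pverts G \<noteq> {}" using surj_weak_homD(1)[OF f u(1)] by blast
  \<comment> \<open>A vertex with the largest left endpoint, found by minimising \<open>- L\<close>.
    When \<open>f\<close> is there, \<open>g\<close> would have to start even further right.\<close>
  then obtain w where w: "w \<in> pverts G" "\<And>v. v \<in> pverts G \<Longrightarrow> L v \<le> L w"
    using arg_min_least[of "pverts G" _ "\<lambda>v. - L v"]
      arg_min_if_finite(1)[of "pverts G" "\<lambda>v. - L v"] fin
    by (metis neg_le_iff_le)
  obtain v where v: "v \<in> pverts P" "f v = w" using surj_weak_homD(3)[OF f w(1)] by blast
  then have "L w < L (g v)" using ord[OF v(1)] LR[OF w(1)] by simp
  then show False using w(2) surj_weak_homD(1)[OF g v(1)] by force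
qed

text \<open>This supplies the hypothesis \<open>meet\<close> of
  \<open>strong_vertex_span_eq_1\<close>.\<close>

lemma aug_interval_meet:
  fixes l r :: "'a \<Rightarrow> real"
  assumes G: "pair_graph G" and H: "pair_graph H" and disj: "pverts G \<inter> pverts H = {}"
    and ne: "pverts G \<noteq> {}"
    and lr: "\<And>v. v \<in> pverts G \<Longrightarrow> l v \<le> r v"
    and adj: "\<And>u v. \<lbrakk>u \<in> pverts G; v \<in> pverts G; u \<noteq> v\<rbrakk> \<Longrightarrow>
      (u, v) \<in> parcs G \<longleftrightarrow> l u \<le> r v \<and> l v \<le> r u"
    and K: "K = {v \<in> pverts G. l v \<le> p \<and> p \<le> r v}"
    and P: "path_graph P" and f: "surj_weak_hom P (aug G K H) f" and g: "surj_weak_hom P (aug G K H) g"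
  shows "\<exists>u \<in> pverts P. f u = g u \<or> (f u, g u) \<in> parcs (aug G K H)"
proof (rule ccontr)
  assume "\<not> ?thesis"
  then have far: "f u \<noteq> g u" "(f u, g u) \<notin> parcs (aug G K H)" if "u \<in> pverts P" for u
    using that by auto
  interpret G: pair_graph G by fact
  interpret H: pair_graph H by fact
  have "K \<subseteq> pverts G" using K by blast
  interpret A: pair_graph "aug G K H" by (rule pair_graph_aug) fact+
  define L where "L v = (if v \<in> pverts H then p else l v)" for v
  define R where "R v = (if v \<in> pverts H then p else r v)" for v
  have LR: "L v \<le> R v" if "v \<in> pverts (aug G K H)" for v
    using that lr unfolding L_def R_def by auto
  have adjG: "l u \<le> r v \<and> l v \<le> r u \<and> u \<notin> pverts H \<and> v \<notin> pverts H" if "(u, v) \<in> parcs G" for u v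
  proof -
    have "u \<in> pverts G" "v \<in> pverts G" "u \<noteq> v"
      using that by (auto dest: G.wellformed' G.no_loops')
    then show ?thesis using that adj[of u v] disj by blast
  qed
  have K_iff: "v \<in> K \<longleftrightarrow> l v \<le> p \<and> p \<le> r v" if "v \<in> pverts G" for v
    using that unfolding K by simp
  have KL: "l v \<le> p \<and> p \<le> r v \<and> v \<notin> pverts H" if "v \<in> K" for v
    using that K_iff[of v] \<open>K \<subseteq> pverts G\<close> disj by blast
  have adjLR: "L u \<le> R v \<and> L v \<le> R u" if "(u, v) \<in> parcs (aug G K H)" for u v
    using that adjG[of u v] KL[of u] KL[of v] H.wellformed'[of u v] unfolding L_def R_def by auto
  \<comment> \<open>A vertex of \<open>G\<close> whose interval meets the point of \<open>H\<close>
    contains \<open>p\<close>, hence lies in \<open>K\<close> and is joined to all of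
    \<open>H\<close>.\<close>
  have overlap: "u = v \<or> (u, v) \<in> parcs (aug G K H) \<or> (u \<in> pverts H \<and> v \<in> pverts H)"
    if "u \<in> pverts (aug G K H)" "v \<in> pverts (aug G K H)" "L u \<le> R v" "L v \<le> R u" for u v
  proof (cases "u \<in> pverts H"; cases "v \<in> pverts H")
    assume "u \<in> pverts H" "v \<notin> pverts H"
    then show ?thesis using that K_iff[of v] by (simp add: L_def R_def)
  next
    assume "u \<notin> pverts H" "v \<in> pverts H"
    then show ?thesis using that K_iff[of u] by (simp add: L_def R_def)
  next
    assume "u \<notin> pverts H" "v \<notin> pverts H"
    then have "u \<in> pverts G" "v \<in> pverts G" "l u \<le> r v" "l v \<le> r u"
      using that by (simp_all add: L_def R_def)
    then show ?thesis using adj[of u v] by (cases "u = v") simp_all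
  qed simp
  have leave: "v \<in> K \<union> pverts H" if "u = v \<or> (u, v) \<in> parcs (aug G K H)" "u \<in> pverts H" for u v
    using that adjG[of u v] KL[of u] H.in_arcsD2[of u v]
    unfolding aug_simps Un_iff mem_Sigma_iff by blast
  have clique: "(u, v) \<in> parcs G" if "u \<in> K" "v \<in> K" "u \<noteq> v" for u v
  proof -
    have "u \<in> pverts G" "v \<in> pverts G" using that \<open>K \<subseteq> pverts G\<close> by blast+
    moreover have "l u \<le> r v" "l v \<le> r u" using KL[OF that(1)] KL[OF that(2)] by linarith+
    ultimately show ?thesis using adj that(3) by blast
  qed
  \<comment> \<open>If both were in \<open>H\<close> once, they would be there along the whole path,
    and \<open>f\<close> would miss the vertices of \<open>G\<close>.\<close>
  have notH: "\<not> (f u \<in> pverts H \<and> g u \<in> pverts H)" if u: "u \<in> pverts P" for u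
  proof
    assume uH: "f u \<in> pverts H \<and> g u \<in> pverts H"
    have "f v \<in> pverts H \<and> g v \<in> pverts H" if "v \<in> pverts P" for v
    proof (rule path_graph_induct[where Q = "\<lambda>v. f v \<in> pverts H \<and> g v \<in> pverts H", OF P u uH that])
      fix x y assume xy: "(x, y) \<in> parcs P" "f x \<in> pverts H \<and> g x \<in> pverts H"
      then have y: "y \<in> pverts P"
        using P unfolding path_graph_def by auto
      have "f y \<in> K \<union> pverts H" "g y \<in> K \<union> pverts H"
        using leave[OF surj_weak_homD(2)[OF f xy(1)]] leave[OF surj_weak_homD(2)[OF g xy(1)]] xy(2)
        by blast+
      moreover have "f y \<noteq> g y" "(f y, g y) \<notin> parcs (aug G K H)" using far[OF y] .
      ultimately show "f y \<in> pverts H \<and> g y \<in> pverts H"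
        using clique[of "f y" "g y"] unfolding aug_simps Un_iff mem_Sigma_iff by blast
    qed
    then show False
      using ne disj surj_weak_homD(3)[OF f] by force
  qed
  have ord: "R (f u) < L (g u) \<or> R (g u) < L (f u)" if "u \<in> pverts P" for u
    using overlap[of "f u" "g u"] far notH that surj_weak_homD(1)[OF f] surj_weak_homD(1)[OF g]
    by force
  obtain u where u: "u \<in> pverts P" using path_graph_finite[OF P] by blast
  from ord[OF u] show False
  proof
    assume "R (f u) < L (g u)"
    then show False
      using no_order_preserving_pair[where L = L and R = R, OF P f g A.pair_finite_verts LR adjLR ord u]
      by blast
  next
    assume "R (g u) < L (f u)"
    moreover have "\<And>v. v \<in> pverts P \<Longrightarrow> R (g v) < L (f v) \<or> R (f v) < L (g v)"
      using ord by blast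
    ultimately show False
      using no_order_preserving_pair[where L = L and R = R, OF P g f A.pair_finite_verts LR adjLR _ u]
      by blast
  qed
qed

theorem theorem3p9:
  fixes G H G' :: "'a pair_pre_digraph" and K :: "'a set"
  assumes "pair_graph G" and "connected (with_proj G)" and "interval_graph G"
    and "minimal_cut_set G K"
    and "pair_graph H" and "connected (with_proj H)"
    and "pverts G \<inter> pverts H = {}"
    and "G' = aug G K H"
  shows "strong_vertex_span G' = 1"
proof -
  interpret G: pair_graph G by fact
  have cut: "cut_set G K" and K: "K \<subseteq> pverts G"
    using assms(4) unfolding minimal_cut_set_def cut_set_def by auto
  interpret G': pair_graph G'
    using pair_graph_aug assms K by blast
  \<comment> \<open>A vertex of \<open>K\<close> links \<open>G\<close> with \<open>H\<close>; the
    vertices \<open>k\<close> and \<open>h\<close> are distinct because the graphs are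
    disjoint.\<close>
  have "K \<noteq> {}" using cut by (rule G.cut_set_nonempty)
  then obtain k where k: "k \<in> pverts G" using K by blast
  obtain h where h: "h \<in> pverts H"
    using assms(6) by (auto simp: connected_conv)
  obtain l r :: "'a \<Rightarrow> real" where lr: "\<And>v. v \<in> pverts G \<Longrightarrow> l v \<le> r v"
    "\<And>u v. \<lbrakk>u \<in> pverts G; v \<in> pverts G; u \<noteq> v\<rbrakk> \<Longrightarrow> (u, v) \<in> parcs G \<longleftrightarrow> l u \<le> r v \<and> l v \<le> r u"
    using interval_graph_endpoints[OF assms(3)] by blast
  obtain p where p: "K = {v \<in> pverts G. l v \<le> p \<and> p \<le> r v}"
    using G.minimal_cut_set_interval[OF assms(2,4) lr] by blast
  show ?thesis
  proof (rule G'.strong_vertex_span_eq_1)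
    show "strongly_connected (with_proj G')"
      using strongly_connected_aug assms K \<open>K \<noteq> {}\<close> by blast
    show "k \<in> pverts G'" "h \<in> pverts G'" "k \<noteq> h"
      using k h assms by auto
    show "\<exists>u \<in> pverts P. f u = g u \<or> (f u, g u) \<in> parcs G'"
      if "path_graph P" "surj_weak_hom P G' f" "surj_weak_hom P G' g"
      for P :: "nat pair_pre_digraph" and f g
      using aug_interval_meet[OF assms(1,5,7) _ lr p] that k assms(8) by blast
  qed
qed

end
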